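(* Let $f:\mathbb{R}\to\mathbb{R}$ be a function of one variable. The following assertions are equivalent: (a) $f$ is a measurable solution of the Cauchy functional equation $$f(x+y)=f(x)+f(y)\quad\text{for all } x,y\in\mathbb{R}.$$ (b) $f$ is a measurable function such that for any fixed $t\ge 0$ and for all $x\in\mathbb{R}$, $$f(x+W_t)=f(x)+f(W_t)\quad P\text{-a.s.}$$ (c) The process $(f(W_t),\,t\ge 0)$ belongs to $\mathcal{M}$, i.e. it is a martingale with $P$-a.s. right-continuous paths, and it is zero at time zero. (d) $f(x)=cx$ for all $x\in\mathbb{R}$, for some constant $c\in\mathbb{R}$.
   Context: $W=(W_t,t\ge 0)$ is a standard Brownian motion (so $W_0=0$) on a complete probability space $(\Omega,\mathcal{F},P)$. $(\mathcal{F}_t)_{t\ge 0}$ is a filtration satisfying the usual conditions of right-continuity and completeness, containing the filtration generated by $W$, such that $W_t-W_s$ is independent of $\mathcal{F}_s$ whenever $0\le s\le t$ (so $W$ is a Brownian motion with respect to $(\mathcal{F}_t)$), and large enough to support an additional Brownian motion $B$ independent of $W$. $\mathcal{M}$ denotes the class of $(\mathcal{F}_t)$-martingales with $P$-almost surely right-continuous paths. "Measurable" means Lebesgue measurable; only Lebesgue measurable real functions are considered. *)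

theory Defs
  imports "HOL-Probability.Probability"
begin

text \<open>
  Processes and filtrations are indexed by \<^typ>\<open>real\<close>, but only their values at times
  \<open>t \<ge> 0\<close> are ever constrained. A member of a filtration is a \<^typ>\<open>'a measure\<close> of which only
  the underlying space and the sigma-algebra matter, as in the library's \<^const>\<open>subalgebra\<close>.
\<close>

definition process_sigma :: "'a measure \<Rightarrow> (real \<Rightarrow> 'a \<Rightarrow> real) \<Rightarrow> real set \<Rightarrow> 'a measure" where
  "process_sigma M X I =
     sigma (space M) {X s -` A \<inter> space M | s A. s \<in> I \<and> A \<in> sets borel}"

definition standard_brownian_motion :: "'a measure \<Rightarrow> (real \<Rightarrow> 'a \<Rightarrow> real) \<Rightarrow> bool" where
  "standard_brownian_motion M W \<longleftrightarrow>
     (\<forall>t\<ge>0. W t \<in> borel_measurable M) \<and>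
     (AE \<omega> in M. W 0 \<omega> = 0) \<and>
     (AE \<omega> in M. continuous_on {0..} (\<lambda>t. W t \<omega>)) \<and>
     (\<forall>s t. 0 \<le> s \<and> s < t \<longrightarrow>
        distributed M lborel (\<lambda>\<omega>. W t \<omega> - W s \<omega>) (normal_density 0 (sqrt (t - s)))) \<and>
     (\<forall>(n::nat) \<tau>. 0 \<le> \<tau> 0 \<and> (\<forall>i<n. \<tau> i \<le> \<tau> (Suc i)) \<longrightarrow>
        prob_space.indep_vars M (\<lambda>_. borel) (\<lambda>i \<omega>. W (\<tau> (Suc i)) \<omega> - W (\<tau> i) \<omega>) {..<n})"

definition usual_filtration :: "'a measure \<Rightarrow> (real \<Rightarrow> 'a measure) \<Rightarrow> bool" where
  "usual_filtration M F \<longleftrightarrow>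
     (\<forall>t\<ge>0. subalgebra M (F t)) \<and>
     (\<forall>s t. 0 \<le> s \<and> s \<le> t \<longrightarrow> sets (F s) \<subseteq> sets (F t)) \<and>
     (\<forall>t\<ge>0. sets (F t) = (\<Inter>u\<in>{t<..}. sets (F u))) \<and>
     (\<forall>t\<ge>0. null_sets M \<subseteq> sets (F t))"

definition brownian_motion_wrt ::
    "'a measure \<Rightarrow> (real \<Rightarrow> 'a measure) \<Rightarrow> (real \<Rightarrow> 'a \<Rightarrow> real) \<Rightarrow> bool" where
  "brownian_motion_wrt M F W \<longleftrightarrow>
     standard_brownian_motion M W \<and>
     (\<forall>t\<ge>0. sets (process_sigma M W {0..t}) \<subseteq> sets (F t)) \<and>
     (\<forall>s t. 0 \<le> s \<and> s \<le> t \<longrightarrow>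
        prob_space.indep_set M (sets (F s))
          {(\<lambda>\<omega>. W t \<omega> - W s \<omega>) -` A \<inter> space M | A. A \<in> sets borel})"

definition independent_processes ::
    "'a measure \<Rightarrow> (real \<Rightarrow> 'a \<Rightarrow> real) \<Rightarrow> (real \<Rightarrow> 'a \<Rightarrow> real) \<Rightarrow> bool" where
  "independent_processes M X Y \<longleftrightarrow>
     prob_space.indep_set M (sets (process_sigma M X {0..})) (sets (process_sigma M Y {0..}))"

text \<open>
  The last conjunct says that the filtration is large enough to support a further Brownian
  motion independent of \<open>W\<close>; it is again a Brownian motion with respect to \<open>F\<close>.
\<close>

definition brownian_setup ::
    "'a measure \<Rightarrow> (real \<Rightarrow> 'a measure) \<Rightarrow> (real \<Rightarrow> 'a \<Rightarrow> real) \<Rightarrow> bool" where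
  "brownian_setup M F W \<longleftrightarrow>
     prob_space M \<and> complete_measure M \<and>
     usual_filtration M F \<and>
     brownian_motion_wrt M F W \<and>
     (\<exists>B. brownian_motion_wrt M F B \<and> independent_processes M W B)"

definition martingale ::
    "'a measure \<Rightarrow> (real \<Rightarrow> 'a measure) \<Rightarrow> (real \<Rightarrow> 'a \<Rightarrow> real) \<Rightarrow> bool" where
  "martingale M F X \<longleftrightarrow>
     (\<forall>t\<ge>0. X t \<in> borel_measurable (F t)) \<and>
     (\<forall>t\<ge>0. integrable M (X t)) \<and>
     (\<forall>s t. 0 \<le> s \<and> s \<le> t \<longrightarrow> (AE \<omega> in M. real_cond_exp M (F s) (X t) \<omega> = X s \<omega>))"

definition rc_martingales ::
    "'a measure \<Rightarrow> (real \<Rightarrow> 'a measure) \<Rightarrow> (real \<Rightarrow> 'a \<Rightarrow> real) set" where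
  "rc_martingales M F =
     {X. martingale M F X \<and>
         (AE \<omega> in M. \<forall>t\<ge>0. continuous (at_right t) (\<lambda>s. X s \<omega>))}"

end

theory Submission
  imports Defs "HOL-Real_Asymp.Real_Asymp"
begin

text \<open>
  Every assertion is compared with linearity. That (a) implies (b), and that a linear function
  satisfies (a) and (c), are quick: linear functions of Brownian motion are martingales because
  an increment is centred and independent of the past. Two implications carry the content.

  From (b) to linearity. The law of \<open>W\<^sub>1\<close> has a positive density, so an almost sure statement
  about \<open>W\<^sub>1\<close> is a Lebesgue-almost everywhere statement. Hence, for each \<open>x\<close>, the Cauchy equation
  holds for almost every \<open>y\<close>; comparing two ways of evaluating \<open>f (x + y + z)\<close> at a generic \<open>z\<close>
  gives it everywhere (\<open>AE_additive_imp_additive\<close>). A measurable additive function is bounded on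
  an interval, because a set on which it is bounded has large measure and meets its small
  translates; so it is linear (\<open>measurable_additive_imp_linear\<close>).

  From (c) to linearity. Here \<open>f\<close> is not known to be measurable, but right-continuity of the
  paths of \<open>f (W\<^sub>t)\<close> yields much more: when a continuous path crosses a level \<open>a\<close> upwards, just
  after its last visit to \<open>a\<close> it sweeps out a right neighbourhood of \<open>a\<close>, so \<open>f\<close> is
  right-continuous at \<open>a\<close>, and downward crossings give left-continuity. Brownian paths cross
  every level in both directions with positive probability, so \<open>f\<close> is continuous. The martingale
  property together with the independence of increments then says that \<open>f\<close> equals its own mean
  against every centred Gaussian, first almost everywhere and then, by continuity, at every point.

  A continuous function with this Gaussian mean value property is affine
  (\<open>gaussian_harmonic_imp_affine\<close>), by a maximum principle that plays the role of stopping \<open>W\<close> at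
  the exit from an interval. If \<open>f\<close> exceeded one of its chords, then adding a small multiple
  \<open>\<epsilon>\<close> of a convex quadratic would still leave an interior maximum. The Gaussian mean of variance
  \<open>u\<close> of the modified function exceeds its value there by exactly \<open>\<epsilon> * u\<close>; but near the maximum
  nothing is gained, and the Gaussian tail contributes only \<open>o(u)\<close> as \<open>u\<close> tends to \<open>0\<close>.
  Finally \<open>f 0 = 0\<close>, as \<open>W\<close> starts at \<open>0\<close>, and the affine function \<open>f\<close> is linear.
\<close>

section \<open>Additive functions\<close>

lemma additive_of_nat_mult:
  fixes f :: "real \<Rightarrow> real"
  assumes add: "\<And>x y. f (x + y) = f x + f y"
  shows "f (of_nat n * x) = of_nat n * f x"
proof (induction n)
  case 0
  show ?case using add[of 0 0] by simp
next
  case (Suc n)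
  then show ?case using add[of x "of_nat n * x"] by (simp add: algebra_simps)
qed

lemma additive_diff:
  fixes f :: "real \<Rightarrow> real"
  assumes add: "\<And>x y. f (x + y) = f x + f y"
  shows "f (x - y) = f x - f y"
  using add[of "x - y" y] by simp

text \<open>
  Subtracting the linear function that agrees with \<open>f\<close> at \<open>0\<close> and \<open>d\<close> leaves an additive function
  \<open>k\<close> with period \<open>d\<close>, which is therefore bounded on the whole line. Since \<open>k (n * x) = n * k x\<close>,
  boundedness forces \<open>k = 0\<close>.
\<close>

lemma additive_bounded_imp_linear:
  fixes f :: "real \<Rightarrow> real"
  assumes add: "\<And>x y. f (x + y) = f x + f y"
    and d: "0 < d" and bounded: "\<And>h. 0 \<le> h \<Longrightarrow> h \<le> d \<Longrightarrow> \<bar>f h\<bar> \<le> C"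
  shows "f x = f d / d * x"
proof -
  define k where "k x = f x - f d / d * x" for x
  have k_add: "k (x + y) = k x + k y" for x y
    by (simp add: k_def add algebra_simps add_divide_distrib)
  have k_d: "k d = 0" using d by (simp add: k_def)
  define K where "K = C + \<bar>f d\<bar>"
  have k_small: "\<bar>k h\<bar> \<le> K" if "0 \<le> h" "h \<le> d" for h
  proof -
    have "\<bar>f d / d * h\<bar> = \<bar>f d\<bar> * (h / d)" using that d by (simp add: abs_mult)
    also have "\<dots> \<le> \<bar>f d\<bar> * 1" using that d by (intro mult_left_mono) auto
    finally show ?thesis using bounded[OF that] unfolding k_def K_def by linarith
  qed
  have k_pos: "\<bar>k x\<bar> \<le> K" if "0 \<le> x" for x
  proof -
    define n where "n = nat \<lfloor>x / d\<rfloor>"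
    have n: "of_nat n = of_int \<lfloor>x / d\<rfloor>" using that d by (simp add: n_def)
    have "of_nat n \<le> x / d" "x / d \<le> of_nat n + 1" unfolding n by linarith+
    then have "0 \<le> x - of_nat n * d" "x - of_nat n * d \<le> d"
      using d by (simp_all add: field_simps)
    then have "\<bar>k (x - of_nat n * d)\<bar> \<le> K" by (rule k_small)
    then show ?thesis
      by (simp add: additive_diff[of k, OF k_add] additive_of_nat_mult[of k, OF k_add] k_d)
  qed
  have k_all: "\<bar>k x\<bar> \<le> K" for x
  proof (cases "0 \<le> x")
    case False
    then show ?thesis
      using k_pos[of "- x"] additive_diff[of k 0 x, OF k_add] additive_diff[of k 0 0, OF k_add] by simp
  qed (rule k_pos)
  have "k x = 0" for x
  proof (rule ccontr)
    assume "k x \<noteq> 0"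
    then obtain n :: nat where "K < of_nat n * \<bar>k x\<bar>"
      using ex_less_of_nat_mult[of "\<bar>k x\<bar>" K] by auto
    then show False
      using k_all[of "of_nat n * x"] by (simp add: additive_of_nat_mult[of k, OF k_add] abs_mult)
  qed
  from this[of x] show ?thesis by (simp add: k_def)
qed

text \<open>
  The sets \<open>E n\<close> where \<open>\<bar>f\<bar> \<le> n\<close> exhaust the unit interval, so one of them has measure above
  \<open>3/4\<close>. For \<open>0 \<le> h \<le> 1/4\<close> that set and its translate by \<open>h\<close> both lie in an interval of length at
  most \<open>5/4 < 3/4 + 3/4\<close>, so they meet, and \<open>f h\<close> is a difference of two values of size at most
  \<open>n\<close>. This is the part of the Steinhaus theorem that the argument requires.
\<close>

lemma measurable_additive_imp_linear:
  fixes f :: "real \<Rightarrow> real"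
  assumes meas: "f \<in> borel_measurable lebesgue"
    and add: "\<And>x y. f (x + y) = f x + f y"
  shows "\<exists>c. \<forall>x. f x = c * x"
proof -
  define E where "E n = {x \<in> {0..1}. \<bar>f x\<bar> \<le> real n}" for n :: nat
  have E_sets: "E n \<in> sets lebesgue" for n
  proof -
    have "E n = {0..1} \<inter> {x \<in> space lebesgue. \<bar>f x\<bar> \<le> real n}" by (auto simp: E_def)
    moreover have "{x \<in> space lebesgue. \<bar>f x\<bar> \<le> real n} \<in> sets lebesgue"
      using meas by measurable
    moreover have "{0..1::real} \<in> sets lebesgue" by simp
    ultimately show ?thesis by (simp add: sets.Int)
  qed
  have "incseq E" by (auto simp: incseq_def E_def)
  moreover have "(\<Union>n. E n) = {0..1}"
    by (auto simp: E_def intro: real_nat_ceiling_ge)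
  ultimately have "(\<lambda>n. emeasure lebesgue (E n)) \<longlonglongrightarrow> emeasure lebesgue {0..1::real}"
    using Lim_emeasure_incseq[of E lebesgue] E_sets by auto
  moreover have "ennreal (3/4) < emeasure lebesgue {0..1::real}"
    by (simp add: ennreal_less_iff del: ennreal_1 flip: ennreal_1)
  ultimately have "\<forall>\<^sub>F n in sequentially. ennreal (3/4) < emeasure lebesgue (E n)"
    by (rule order_tendstoD(1))
  then obtain n where n: "ennreal (3/4) < emeasure lebesgue (E n)"
    by (auto simp: eventually_sequentially)
  have bound: "\<bar>f h\<bar> \<le> 2 * real n" if h: "0 \<le> h" "h \<le> 1/4" for h
  proof -
    let ?T = "(\<lambda>x. h + x) ` E n"
    have T_sets: "?T \<in> sets lebesgue" by (rule lebesgue_sets_translation[OF E_sets])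
    have T_measure: "emeasure lebesgue ?T = emeasure lebesgue (E n)"
      using emeasure_lebesgue_affine[of 1 h "E n"] by (simp add: add.commute)
    have "E n \<inter> ?T \<noteq> {}"
    proof
      assume disjoint: "E n \<inter> ?T = {}"
      have "ennreal (3/4) + ennreal (3/4) \<le> emeasure lebesgue (E n) + emeasure lebesgue ?T"
        unfolding T_measure using n by (intro add_mono) auto
      also have "\<dots> = emeasure lebesgue (E n \<union> ?T)"
        using plus_emeasure[OF E_sets T_sets disjoint] .
      also have "\<dots> \<le> emeasure lebesgue {0..1 + h}"
        using h by (intro emeasure_mono) (auto simp: E_def)
      also have "\<dots> = ennreal (1 + h)" using h by simp
      finally have "3/4 + 3/4 \<le> 1 + h"
        using h by (simp flip: ennreal_plus)
      with h show False by simp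
    qed
    then obtain x where "x \<in> E n" "h + x \<in> E n" by auto
    then have "\<bar>f x\<bar> \<le> real n" "\<bar>f (h + x)\<bar> \<le> real n" by (auto simp: E_def)
    then show ?thesis unfolding add by linarith
  qed
  have "f x = f (1/4) / (1/4) * x" for x
    by (rule additive_bounded_imp_linear[OF add _ bound]) simp_all
  then show ?thesis by blast
qed

section \<open>Functions that are right-continuous along a continuous path\<close>

text \<open>
  After the last time \<open>\<sigma>\<close> in \<open>[s, t]\<close> with \<open>w \<sigma> \<le> a\<close> the path stays above \<open>a\<close>, and by the intermediate
  value theorem it takes, immediately after \<open>\<sigma>\<close>, all values slightly above \<open>a = w \<sigma>\<close>. The right
  limit of \<open>f \<circ> w\<close> at \<open>\<sigma>\<close> is thus the right limit of \<open>f\<close> at \<open>a\<close>.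
\<close>

lemma continuous_at_right_of_upcrossing:
  fixes f w :: "real \<Rightarrow> real"
  assumes cont: "continuous_on {0..} w"
    and rc: "\<And>r. 0 \<le> r \<Longrightarrow> continuous (at_right r) (\<lambda>r. f (w r))"
    and st: "0 \<le> s" "s \<le> t" and cross: "w s < a" "a < w t"
  shows "continuous (at_right a) f"
proof -
  let ?S = "{r \<in> {s..t}. w r \<le> a}"
  define \<sigma> where "\<sigma> = Sup ?S"
  have cont_st: "continuous_on {s..t} w"
    using cont st by (rule_tac continuous_on_subset) auto
  have "closed ({s..t} \<inter> w -` {..a})"
    by (rule continuous_closed_preimage[OF cont_st]) auto
  also have "{s..t} \<inter> w -` {..a} = ?S" by auto
  finally have "closed ?S" .
  moreover have "?S \<noteq> {}" using st cross by force
  moreover have bdd: "bdd_above ?S" by (rule bdd_aboveI[of _ t]) auto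
  ultimately have "\<sigma> \<in> ?S" unfolding \<sigma>_def by (rule_tac closed_contains_Sup)
  then have \<sigma>: "s \<le> \<sigma>" "\<sigma> \<le> t" "w \<sigma> \<le> a" by auto
  with cross have "\<sigma> < t" by (cases "\<sigma> = t") auto
  have after: "a < w r" if "\<sigma> < r" "r \<le> t" for r
  proof (rule ccontr)
    assume "\<not> a < w r"
    then have "r \<in> ?S" using that \<sigma> by auto
    then have "r \<le> \<sigma>" unfolding \<sigma>_def by (rule cSup_upper[OF _ bdd])
    then show False using that by simp
  qed
  have "w \<sigma> = a"
  proof (rule ccontr)
    assume "w \<sigma> \<noteq> a"
    then have "w \<sigma> < a" using \<sigma> by simp
    then obtain r where "\<sigma> \<le> r" "r \<le> t" "w r = a"
      using IVT'[of w \<sigma> a t] cross \<sigma> continuous_on_subset[OF cont_st, of "{\<sigma>..t}"] by auto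
    moreover from this have "r \<noteq> \<sigma>" using \<open>w \<sigma> \<noteq> a\<close> by auto
    ultimately show False using after[of r] by auto
  qed
  have lim: "((\<lambda>r. f (w r)) \<longlongrightarrow> f a) (at_right \<sigma>)"
    using rc[of \<sigma>] \<sigma> st \<open>w \<sigma> = a\<close> by (simp add: continuous_within)
  have "(f \<longlongrightarrow> f a) (at_right a)"
  proof (rule topological_tendstoI)
    fix U assume "open U" "f a \<in> U"
    then have "\<forall>\<^sub>F r in at_right \<sigma>. f (w r) \<in> U" using lim by (rule_tac topological_tendstoD)
    then obtain b where b: "\<sigma> < b" "\<And>r. \<sigma> < r \<Longrightarrow> r < b \<Longrightarrow> f (w r) \<in> U"
      unfolding eventually_at_right_field by auto
    obtain r1 where r1: "\<sigma> < r1" "r1 < min b t"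
      using dense[of \<sigma> "min b t"] b \<open>\<sigma> < t\<close> by auto
    have "f y \<in> U" if y: "a < y" "y < w r1" for y
    proof -
      obtain r where "\<sigma> \<le> r" "r \<le> r1" "w r = y"
        using IVT'[of w \<sigma> y r1] y r1 \<sigma> \<open>w \<sigma> = a\<close> continuous_on_subset[OF cont_st, of "{\<sigma>..r1}"] by auto
      moreover from this have "r \<noteq> \<sigma>" using y \<open>w \<sigma> = a\<close> by auto
      ultimately show ?thesis using b(2)[of r] r1 by auto
    qed
    moreover have "a < w r1" using after[of r1] r1 by simp
    ultimately show "\<forall>\<^sub>F y in at_right a. f y \<in> U"
      unfolding eventually_at_right_field by blast
  qed
  then show ?thesis by (simp add: continuous_within)
qed

lemma continuous_at_left_of_downcrossing:
  fixes f w :: "real \<Rightarrow> real"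
  assumes cont: "continuous_on {0..} w"
    and rc: "\<And>r. 0 \<le> r \<Longrightarrow> continuous (at_right r) (\<lambda>r. f (w r))"
    and st: "0 \<le> s" "s \<le> t" and cross: "a < w s" "w t < a"
  shows "continuous (at_left a) f"
proof -
  have "continuous (at_right (- a)) (\<lambda>x. f (- x))"
  proof (rule continuous_at_right_of_upcrossing[where w = "\<lambda>r. - w r"])
    show "continuous_on {0..} (\<lambda>r. - w r)" using cont by (intro continuous_intros)
  qed (use rc st cross in auto)
  then have "(f \<longlongrightarrow> f a) (at_left a)"
    by (simp add: continuous_within at_left_minus[of a] filterlim_filtermap)
  then show ?thesis by (simp add: continuous_within)
qed

section \<open>The Gaussian mean value property\<close>

text \<open>
  In terms of the heat semigroup this says \<open>P\<^sub>u f = f\<close> for all \<open>u > 0\<close>, where \<open>u\<close> is the variance of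
  the Gaussian; integrability at every variance and every centre is part of the condition.
\<close>

definition gaussian_harmonic :: "(real \<Rightarrow> real) \<Rightarrow> bool" where
  "gaussian_harmonic f \<longleftrightarrow>
     (\<forall>u>0. \<forall>x. has_bochner_integral lborel (\<lambda>y. normal_density 0 (sqrt u) y * f (x + y)) (f x))"

lemma gaussian_harmonicD:
  "gaussian_harmonic f \<Longrightarrow> 0 < u \<Longrightarrow>
     has_bochner_integral lborel (\<lambda>y. normal_density 0 (sqrt u) y * f (x + y)) (f x)"
  by (simp add: gaussian_harmonic_def)

lemma gaussian_harmonic_uminus: "gaussian_harmonic f \<Longrightarrow> gaussian_harmonic (\<lambda>x. - f x)"
  unfolding gaussian_harmonic_def
  by (auto dest!: has_bochner_integral_minus simp: algebra_simps)

text \<open>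
  Away from the origin the density of variance \<open>u\<close> is dominated by the standard one, with a factor
  that vanishes faster than any power of \<open>u\<close>. So integrability against the standard density alone
  controls all small-variance tails.
\<close>

lemma normal_density_tail_le:
  assumes u: "0 < u" "u \<le> 1" and d: "0 \<le> d" "d \<le> \<bar>y\<bar>"
  shows "normal_density 0 (sqrt u) y \<le>
     (1 / sqrt u * exp (- d\<^sup>2 / 2 * (1 / u - 1))) * normal_density 0 1 y"
proof -
  have "d\<^sup>2 \<le> y\<^sup>2" using d by (metis abs_le_square_iff abs_of_nonneg)
  moreover have "0 \<le> 1 / u - 1" using u by simp
  ultimately have "d\<^sup>2 * (1 / u - 1) \<le> y\<^sup>2 * (1 / u - 1)" by (rule mult_right_mono)
  then have "- y\<^sup>2 / (2 * u) \<le> - d\<^sup>2 / 2 * (1 / u - 1) + - y\<^sup>2 / 2"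
    by (simp add: field_simps)
  then have "exp (- y\<^sup>2 / (2 * u)) \<le> exp (- d\<^sup>2 / 2 * (1 / u - 1)) * exp (- y\<^sup>2 / 2)"
    by (simp add: exp_le_cancel_iff flip: exp_add)
  then have "1 / sqrt (2 * pi) * (1 / sqrt u) * exp (- y\<^sup>2 / (2 * u)) \<le>
      1 / sqrt (2 * pi) * (1 / sqrt u) * (exp (- d\<^sup>2 / 2 * (1 / u - 1)) * exp (- y\<^sup>2 / 2))"
    using u by (intro mult_left_mono) auto
  then show ?thesis
    using u by (simp add: normal_density_def real_sqrt_mult mult_ac)
qed

text \<open>
  Doubling the variance absorbs a bounded shift of the centre, because
  \<open>y\<^sup>2 / 2 \<le> (y - x)\<^sup>2 + x\<^sup>2\<close>. This makes Gaussian means integrable at every centre and gives a common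
  dominating function for centres in a bounded set.
\<close>

lemma normal_density_shift_le:
  assumes u: "0 < u" and x: "\<bar>x\<bar> \<le> R"
  shows "normal_density 0 (sqrt u) (y - x) \<le>
     sqrt 2 * exp (R\<^sup>2 / (2 * u)) * normal_density 0 (sqrt (2 * u)) y"
proof -
  have "x\<^sup>2 \<le> R\<^sup>2" using x by (metis abs_ge_zero power2_abs power_mono)
  moreover have "0 \<le> (y - 2 * x)\<^sup>2" by simp
  ultimately have "y\<^sup>2 / 2 \<le> (y - x)\<^sup>2 + R\<^sup>2" by (simp add: power2_eq_square algebra_simps)
  then have "- (y - x)\<^sup>2 / (2 * u) \<le> R\<^sup>2 / (2 * u) + - y\<^sup>2 / (2 * (2 * u))"
    using u by (simp add: field_simps)
  then have "exp (- (y - x)\<^sup>2 / (2 * u)) \<le> exp (R\<^sup>2 / (2 * u)) * exp (- y\<^sup>2 / (2 * (2 * u)))"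
    by (simp add: exp_le_cancel_iff flip: exp_add)
  then have "1 / sqrt (2 * pi * u) * exp (- (y - x)\<^sup>2 / (2 * u)) \<le>
      1 / sqrt (2 * pi * u) * (exp (R\<^sup>2 / (2 * u)) * exp (- y\<^sup>2 / (2 * (2 * u))))"
    using u by (intro mult_left_mono) auto
  moreover have "sqrt (2 * pi * (2 * u)) = sqrt 2 * sqrt (2 * pi * u)"
    by (simp flip: real_sqrt_mult)
  ultimately show ?thesis
    using u by (simp add: normal_density_def mult_ac)
qed

text \<open>
  The hypothesis says that \<open>f\<close> plus a strictly convex quadratic has a local maximum at \<open>x\<close>. The linear
  term has Gaussian mean \<open>0\<close> and the quadratic one has mean \<open>\<epsilon> * u\<close>, so by the mean
  value property the increment \<open>k\<close> of the sum has mean \<open>\<epsilon> * u\<close>. As \<open>k \<le> 0\<close> near \<open>0\<close>, this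
  mean is bounded by a tail integral, which is \<open>o(u)\<close>.
\<close>

lemma gaussian_harmonic_no_strict_local_max:
  assumes harm: "gaussian_harmonic f" and \<epsilon>: "0 < \<epsilon>" and d: "0 < d"
    and le: "\<And>y. \<bar>y\<bar> < d \<Longrightarrow> f (x + y) + \<epsilon> * y\<^sup>2 + \<beta> * y \<le> f x"
  shows False
proof -
  define k where "k y = f (x + y) - f x + \<epsilon> * y\<^sup>2 + \<beta> * y" for y
  let ?\<phi> = "\<lambda>u. normal_density 0 (sqrt u)"
  have k_int: "has_bochner_integral lborel (\<lambda>y. ?\<phi> u y * k y) (\<epsilon> * u)" if u: "0 < u" for u
  proof -
    have const: "has_bochner_integral lborel (\<lambda>y. ?\<phi> u y * f x) (f x)"
      using has_bochner_integral_mult_left[OF normal_moment_even[of "sqrt u" 0 0], of "f x"] u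
      by simp
    have lin: "has_bochner_integral lborel (\<lambda>y. \<beta> * (?\<phi> u y * y)) 0"
      using has_bochner_integral_mult_right[OF normal_moment_odd[of "sqrt u" 0 0], of \<beta>] u
      by simp
    have sq: "has_bochner_integral lborel (\<lambda>y. \<epsilon> * (?\<phi> u y * y\<^sup>2)) (\<epsilon> * u)"
      using has_bochner_integral_mult_right[OF normal_moment_even[of "sqrt u" 0 1], of \<epsilon>] u
      by simp
    have "has_bochner_integral lborel
       (\<lambda>y. ?\<phi> u y * f (x + y) - ?\<phi> u y * f x + \<epsilon> * (?\<phi> u y * y\<^sup>2) + \<beta> * (?\<phi> u y * y))
       (f x - f x + \<epsilon> * u + 0)"
      by (intro has_bochner_integral_add has_bochner_integral_diff
            gaussian_harmonicD[OF harm u] const lin sq)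
    then show ?thesis by (simp add: k_def algebra_simps)
  qed
  define K where "K = (\<integral>y. normal_density 0 1 y * \<bar>k y\<bar> \<partial>lborel)"
  have abs_int: "integrable lborel (\<lambda>y. normal_density 0 1 y * \<bar>k y\<bar>)"
    using integrable_abs[OF integrable.intros[OF k_int[of 1]]] by (simp add: abs_mult)
  have bound: "\<epsilon> * u \<le> 1 / sqrt u * exp (- d\<^sup>2 / 2 * (1 / u - 1)) * K" if u: "0 < u" "u \<le> 1" for u
  proof -
    let ?c = "1 / sqrt u * exp (- d\<^sup>2 / 2 * (1 / u - 1))"
    have "\<epsilon> * u = (\<integral>y. ?\<phi> u y * k y \<partial>lborel)"
      using has_bochner_integral_integral_eq[OF k_int[OF u(1)]] by simp
    also have "\<dots> \<le> (\<integral>y. ?c * (normal_density 0 1 y * \<bar>k y\<bar>) \<partial>lborel)"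
    proof (rule integral_mono)
      show "integrable lborel (\<lambda>y. ?\<phi> u y * k y)"
        using k_int[OF u(1)] by (rule integrable.intros)
      show "integrable lborel (\<lambda>y. ?c * (normal_density 0 1 y * \<bar>k y\<bar>))"
        using abs_int by (rule integrable_mult_right)
      fix y
      have nonneg: "0 \<le> ?c * (normal_density 0 1 y * \<bar>k y\<bar>)" using u by simp
      show "?\<phi> u y * k y \<le> ?c * (normal_density 0 1 y * \<bar>k y\<bar>)"
      proof (cases "\<bar>y\<bar> < d")
        case True
        then have "k y \<le> 0" using le[of y] by (simp add: k_def)
        then have "?\<phi> u y * k y \<le> 0" by (simp add: mult_nonneg_nonpos)
        then show ?thesis using nonneg by linarith
      next
        case False
        have "?\<phi> u y * k y \<le> ?\<phi> u y * \<bar>k y\<bar>" by (intro mult_left_mono) auto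
        also have "\<dots> \<le> ?c * normal_density 0 1 y * \<bar>k y\<bar>"
          using False d u by (intro mult_right_mono normal_density_tail_le) auto
        finally show ?thesis by (simp add: mult.assoc)
      qed
    qed
    also have "\<dots> = ?c * K" by (simp add: K_def)
    finally show ?thesis .
  qed
  \<comment> \<open>Divided by \<open>u\<close>, the bound contradicts \<open>\<epsilon> > 0\<close> in the limit of small variance.\<close>
  have "((\<lambda>u. 1 / sqrt u * exp (- d\<^sup>2 / 2 * (1 / u - 1)) * K / u) \<longlongrightarrow> 0) (at_right 0)"
    using d by real_asymp
  then have "\<forall>\<^sub>F u in at_right 0. 1 / sqrt u * exp (- d\<^sup>2 / 2 * (1 / u - 1)) * K / u < \<epsilon>"
    using \<epsilon> by (rule order_tendstoD(2))
  moreover have "\<forall>\<^sub>F u :: real in at_right 0. u \<in> {0<..<1}"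
    by (rule eventually_at_right_real) simp
  ultimately have "\<forall>\<^sub>F u :: real in at_right 0. False"
  proof eventually_elim
    case (elim u)
    then have "1 / sqrt u * exp (- d\<^sup>2 / 2 * (1 / u - 1)) * K < \<epsilon> * u"
      by (simp add: pos_divide_less_eq mult_ac)
    then show False using bound[of u] elim by auto
  qed
  then show False by (simp add: trivial_limit_at_right_real)
qed

text \<open>
  The maximum principle: if \<open>f\<close> exceeded the affine function by a positive amount at \<open>z\<close>, so would
  \<open>f\<close> after adding \<open>\<epsilon> * (x - p) * (x - q)\<close> with \<open>\<epsilon>\<close> small. This quadratic vanishes at the endpoints, so
  the maximum of the modified difference over \<open>[p, q]\<close> is attained in the interior.
\<close>

lemma gaussian_harmonic_le_chord:
  assumes harm: "gaussian_harmonic f" and cont: "continuous_on UNIV f"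
    and p: "f p \<le> \<alpha> + \<beta> * p" and q: "f q \<le> \<alpha> + \<beta> * q" and z: "p \<le> z" "z \<le> q"
  shows "f z \<le> \<alpha> + \<beta> * z"
proof (rule ccontr)
  assume above: "\<not> ?thesis"
  define g where "g x = f x - (\<alpha> + \<beta> * x)" for x
  have gz: "0 < g z" using above by (simp add: g_def)
  define D where "D = (q - p)\<^sup>2 + 1"
  have den: "0 < D" unfolding D_def by (rule add_nonneg_pos) auto
  \<comment> \<open>This choice makes the added quadratic at least \<open>- g z / 2\<close> at \<open>z\<close>, whatever the position of
    \<open>z\<close> in the interval.\<close>
  define \<epsilon> where "\<epsilon> = g z / (2 * D)"
  have \<epsilon>: "0 < \<epsilon>" using gz den by (simp add: \<epsilon>_def)
  define h where "h x = g x + \<epsilon> * (x - p) * (x - q)" for x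
  have "continuous_on {p..q} h"
    unfolding h_def g_def by (intro continuous_intros continuous_on_subset[OF cont]) auto
  moreover have "{p..q} \<noteq> {}" using z by auto
  ultimately obtain x where x: "x \<in> {p..q}" and max: "\<And>y. y \<in> {p..q} \<Longrightarrow> h y \<le> h x"
    using continuous_attains_sup[of "{p..q}" h, OF compact_Icc] by blast
  have "(z - p) * (q - z) \<le> (q - p) * (q - p)" using z by (intro mult_mono) auto
  then have "\<epsilon> * ((z - p) * (q - z)) \<le> \<epsilon> * D"
    using \<epsilon> by (intro mult_left_mono) (auto simp: D_def power2_eq_square)
  also have "\<dots> = g z / 2" using den by (simp add: \<epsilon>_def)
  finally have "0 < h z" using gz by (simp add: h_def algebra_simps)
  then have hx: "0 < h x" using max[of z] z by auto
  have "h p \<le> 0" "h q \<le> 0" using p q by (simp_all add: h_def g_def)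
  then have "x \<noteq> p" "x \<noteq> q" using hx by auto
  then have "0 < min (x - p) (q - x)" using x by auto
  then show False
  proof (rule gaussian_harmonic_no_strict_local_max[OF harm \<epsilon>])
    fix y assume "\<bar>y\<bar> < min (x - p) (q - x)"
    then have "x + y \<in> {p..q}" by (auto simp: abs_less_iff)
    then have "h (x + y) \<le> h x" by (rule max)
    then show "f (x + y) + \<epsilon> * y\<^sup>2 + (\<epsilon> * (2 * x - p - q) - \<beta>) * y \<le> f x"
      by (simp add: h_def g_def power2_eq_square algebra_simps)
  qed
qed

text \<open>
  Applied to \<open>f\<close> and to \<open>- f\<close>, the chord bound shows that \<open>f\<close> coincides with its chord on every
  interval; an interval containing \<open>0\<close>, \<open>1\<close> and \<open>x\<close> determines the coefficients.
\<close>

lemma gaussian_harmonic_imp_affine: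
  assumes harm: "gaussian_harmonic f" and cont: "continuous_on UNIV f"
  shows "f x = f 0 + (f 1 - f 0) * x"
proof -
  define p where "p = min 0 x"
  define q where "q = max 1 x"
  have pq: "p < q" "p \<le> 0" "1 \<le> q" "p \<le> x" "x \<le> q" by (auto simp: p_def q_def)
  define \<beta> where "\<beta> = (f q - f p) / (q - p)"
  define \<alpha> where "\<alpha> = f p - \<beta> * p"
  have "\<beta> * (q - p) = f q - f p" using pq by (simp add: \<beta>_def)
  then have ends: "f p = \<alpha> + \<beta> * p" "f q = \<alpha> + \<beta> * q" by (simp_all add: \<alpha>_def algebra_simps)
  have chord: "f z = \<alpha> + \<beta> * z" if z: "p \<le> z" "z \<le> q" for z
  proof (rule antisym)
    show "f z \<le> \<alpha> + \<beta> * z"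
      by (rule gaussian_harmonic_le_chord[OF harm cont _ _ z]) (simp_all add: ends)
    have "- f z \<le> - \<alpha> + (- \<beta>) * z"
      by (rule gaussian_harmonic_le_chord[OF gaussian_harmonic_uminus[OF harm] _ _ _ z])
        (simp_all add: ends continuous_on_minus[OF cont])
    then show "\<alpha> + \<beta> * z \<le> f z" by simp
  qed
  show ?thesis using chord[of 0] chord[of 1] chord[of x] pq by (simp add: algebra_simps)
qed

text \<open>
  A set of full Lebesgue measure is dense, since its complement contains no nonempty open set.
\<close>

lemma AE_lborel_sequence:
  fixes P :: "real \<Rightarrow> bool"
  assumes "AE x in lborel. P x"
  obtains X where "\<And>n :: nat. P (X n)" "X \<longlonglongrightarrow> x"
proof -
  have "x \<in> closure {x. P x}"
  proof (rule ccontr)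
    assume "x \<notin> closure {x. P x}"
    then have "\<not> negligible (- closure {x. P x})" by (intro open_not_negligible) auto
    moreover have "negligible (- closure {x. P x})"
    proof -
      obtain N where "N \<in> null_sets lborel" "{x. \<not> P x} \<subseteq> N"
        using assms by (auto elim!: AE_E simp: null_sets_def)
      then have "negligible N" "- closure {x. P x} \<subseteq> N"
        using closure_subset[of "{x. P x}"]
        by (auto simp: negligible_iff_null_sets intro: null_sets_completionI)
      then show ?thesis by (rule negligible_subset)
    qed
    ultimately show False by simp
  qed
  then show ?thesis using that by (auto simp: closure_sequential)
qed

text \<open>
  Both sides of the mean value identity depend continuously on the centre: the left one by dominated
  convergence after moving the centre into the density, the right one by assumption. So the identity
  passes from a dense set of centres to all of them.
\<close>

lemma gaussian_harmonicI_AE: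
  assumes cont: "continuous_on UNIV f"
    and int: "\<And>u. 0 < u \<Longrightarrow> integrable lborel (\<lambda>y. normal_density 0 (sqrt u) y * f y)"
    and mean: "\<And>u. 0 < u \<Longrightarrow>
      AE x in lborel. (\<integral>y. normal_density 0 (sqrt u) y * f (x + y) \<partial>lborel) = f x"
  shows "gaussian_harmonic f"
  unfolding gaussian_harmonic_def
proof (intro allI impI)
  fix u x :: real assume u: "0 < u"
  let ?\<phi> = "normal_density 0 (sqrt u)"
  let ?D = "\<lambda>R y. sqrt 2 * exp (R\<^sup>2 / (2 * u)) * \<bar>normal_density 0 (sqrt (2 * u)) y * f y\<bar>"
  have [measurable]: "f \<in> borel_measurable borel"
    using cont by (rule borel_measurable_continuous_onI)
  have dom: "\<bar>?\<phi> (y - a) * f y\<bar> \<le> ?D R y" if "\<bar>a\<bar> \<le> R" for a R y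
  proof -
    have "\<bar>?\<phi> (y - a) * f y\<bar> = ?\<phi> (y - a) * \<bar>f y\<bar>" by (simp add: abs_mult)
    also have "\<dots> \<le> sqrt 2 * exp (R\<^sup>2 / (2 * u)) * normal_density 0 (sqrt (2 * u)) y * \<bar>f y\<bar>"
      using u that by (intro mult_right_mono normal_density_shift_le) auto
    finally show ?thesis by (simp add: abs_mult mult.assoc)
  qed
  have D_int: "integrable lborel (?D R)" for R
    using int[of "2 * u"] u by (intro integrable_mult_right integrable_abs) auto
  have shifted: "integrable lborel (\<lambda>y. ?\<phi> (y - a) * f y)" for a
    by (rule Bochner_Integration.integrable_bound[OF D_int[of "\<bar>a\<bar>"]])
      (use dom[of a "\<bar>a\<bar>"] in auto)
  have x_int: "integrable lborel (\<lambda>y. ?\<phi> y * f (x + y))"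
    using lborel_integrable_real_affine[OF shifted[of x], of 1 x] by simp
  have shift: "(\<integral>y. ?\<phi> (y - a) * f y \<partial>lborel) = (\<integral>y. ?\<phi> y * f (a + y) \<partial>lborel)" for a
    using lborel_integral_real_affine[of 1 "\<lambda>y. ?\<phi> (y - a) * f y" a] by simp
  obtain X where X: "\<And>n :: nat. (\<integral>y. ?\<phi> y * f (X n + y) \<partial>lborel) = f (X n)" and lim: "X \<longlonglongrightarrow> x"
    using AE_lborel_sequence[OF mean[OF u]] by metis
  obtain R where R: "\<And>n. \<bar>X n\<bar> \<le> R"
    using convergent_imp_bounded[OF lim] by (auto simp: bounded_iff)
  have "(\<lambda>n. \<integral>y. ?\<phi> (y - X n) * f y \<partial>lborel) \<longlonglongrightarrow> (\<integral>y. ?\<phi> (y - x) * f y \<partial>lborel)"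
  proof (rule integral_dominated_convergence[where w = "?D R"])
    show "AE y in lborel. (\<lambda>n. ?\<phi> (y - X n) * f y) \<longlonglongrightarrow> ?\<phi> (y - x) * f y"
      unfolding normal_density_def using u lim by (intro always_eventually allI tendsto_intros) auto
    show "AE y in lborel. norm (?\<phi> (y - X n) * f y) \<le> ?D R y" for n
      using dom[OF R] by simp
  qed (use D_int in auto)
  then have "(\<lambda>n. f (X n)) \<longlonglongrightarrow> (\<integral>y. ?\<phi> y * f (x + y) \<partial>lborel)"
    by (simp only: shift X)
  moreover have "(\<lambda>n. f (X n)) \<longlonglongrightarrow> f x"
    using cont lim by (rule_tac continuous_on_tendsto_compose[where s = UNIV]) auto
  ultimately have "(\<integral>y. ?\<phi> y * f (x + y) \<partial>lborel) = f x" by (rule LIMSEQ_unique)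
  with x_int show "has_bochner_integral lborel (\<lambda>y. ?\<phi> y * f (x + y)) (f x)"
    by (simp add: has_bochner_integral_iff)
qed

section \<open>Distribution and independence of Brownian increments\<close>

lemma brownian_setup_prob_space: "brownian_setup M F W \<Longrightarrow> prob_space M"
  by (simp add: brownian_setup_def)

lemma brownian_subalgebra: "brownian_setup M F W \<Longrightarrow> 0 \<le> t \<Longrightarrow> subalgebra M (F t)"
  by (simp add: brownian_setup_def usual_filtration_def)

lemma brownian_finite_measure_subalgebra:
  assumes "brownian_setup M F W" "0 \<le> t"
  shows "finite_measure_subalgebra M (F t)"
proof -
  interpret prob_space M by (rule brownian_setup_prob_space[OF assms(1)])
  show ?thesis by unfold_locales (rule brownian_subalgebra[OF assms])
qed

lemma brownian_measurable:
  assumes "brownian_setup M F W" "0 \<le> t"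
  shows "W t \<in> borel_measurable M"
  using assms by (simp add: brownian_setup_def brownian_motion_wrt_def standard_brownian_motion_def)

lemma brownian_adapted:
  assumes bm: "brownian_setup M F W" and t: "0 \<le> t"
  shows "W t \<in> borel_measurable (F t)"
proof (rule measurableI)
  have sp: "space (F t) = space M"
    using brownian_subalgebra[OF assms] by (simp add: subalgebra_def)
  fix A :: "real set" assume "A \<in> sets borel"
  then have "W t -` A \<inter> space M \<in> sets (process_sigma M W {0..t})"
    unfolding process_sigma_def using t by (subst sets_measure_of) auto
  then show "W t -` A \<inter> space (F t) \<in> sets (F t)"
    using assms unfolding sp by (auto simp: brownian_setup_def brownian_motion_wrt_def)
qed simp

lemma brownian_start_AE: "brownian_setup M F W \<Longrightarrow> AE \<omega> in M. W 0 \<omega> = 0"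
  by (simp add: brownian_setup_def brownian_motion_wrt_def standard_brownian_motion_def)

lemma brownian_increment_distributed:
  assumes "brownian_setup M F W" "0 \<le> s" "s < t"
  shows "distributed M lborel (\<lambda>\<omega>. W t \<omega> - W s \<omega>) (normal_density 0 (sqrt (t - s)))"
  using assms by (simp add: brownian_setup_def brownian_motion_wrt_def standard_brownian_motion_def)

lemma brownian_distributed:
  assumes bm: "brownian_setup M F W" and t: "0 < t"
  shows "distributed M lborel (W t) (normal_density 0 (sqrt t))"
proof -
  have "AE \<omega> in M. W t \<omega> - W 0 \<omega> = W t \<omega>"
    using brownian_start_AE[OF bm] by eventually_elim simp
  then have "distr M lborel (W t) = distr M lborel (\<lambda>\<omega>. W t \<omega> - W 0 \<omega>)"
    using brownian_measurable[OF bm] t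
    by (intro distr_cong_AE) (auto elim: eventually_mono)
  then show ?thesis
    using brownian_increment_distributed[OF bm, of 0 t] brownian_measurable[OF bm, of t] t
    by (simp add: distributed_def)
qed

lemma Int_stable_vimage_sets: "Int_stable {X -` A \<inter> \<Omega> | A. A \<in> sets N}"
proof (rule Int_stableI)
  fix a b assume "a \<in> {X -` A \<inter> \<Omega> | A. A \<in> sets N}" "b \<in> {X -` A \<inter> \<Omega> | A. A \<in> sets N}"
  then obtain A B where "A \<in> sets N" "B \<in> sets N" "a = X -` A \<inter> \<Omega>" "b = X -` B \<inter> \<Omega>" by auto
  then show "a \<inter> b \<in> {X -` A \<inter> \<Omega> | A. A \<in> sets N}"
    by (auto intro!: exI[of _ "A \<inter> B"])
qed

lemma brownian_indep_increment:
  assumes bm: "brownian_setup M F W" and st: "0 \<le> s" "s \<le> t"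
    and X: "X \<in> borel_measurable (F s)"
  shows "prob_space.indep_var M borel X borel (\<lambda>\<omega>. W t \<omega> - W s \<omega>)"
proof -
  interpret prob_space M by (rule brownian_setup_prob_space[OF bm])
  let ?Y = "\<lambda>\<omega>. W t \<omega> - W s \<omega>"
  have sub: "subalgebra M (F s)" using brownian_subalgebra[OF bm st(1)] .
  then have sp: "space (F s) = space M" by (simp add: subalgebra_def)
  have Xm: "X \<in> borel_measurable M" using measurable_from_subalg[OF sub X] .
  have Ym: "?Y \<in> borel_measurable M"
    using brownian_measurable[OF bm, of s] brownian_measurable[OF bm, of t] st by simp
  have ind: "indep_set (sets (F s)) {?Y -` A \<inter> space M | A. A \<in> sets borel}"
    using bm st by (simp add: brownian_setup_def brownian_motion_wrt_def)
  have "indep_set {X -` A \<inter> space M | A. A \<in> sets borel} {?Y -` A \<inter> space M | A. A \<in> sets borel}"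
  proof (rule indep_setI)
    fix a b
    assume "a \<in> {X -` A \<inter> space M | A. A \<in> sets borel}" and b: "b \<in> {?Y -` A \<inter> space M | A. A \<in> sets borel}"
    then have "a \<in> sets (F s)" using measurable_sets[OF X] by (auto simp: sp)
    then show "prob (a \<inter> b) = prob a * prob b" by (rule indep_setD[OF ind _ b])
  qed (use Xm Ym in \<open>auto intro: measurable_sets\<close>)
  then show ?thesis
    unfolding indep_var_eq using Xm Ym
    by (intro conjI indep_set_sigma_sets Int_stable_vimage_sets)
qed

lemma brownian_joint_distributed:
  assumes bm: "brownian_setup M F W" and s: "0 < s" and u: "0 < u"
  shows "distributed M (lborel \<Otimes>\<^sub>M lborel) (\<lambda>\<omega>. (W s \<omega>, W (s + u) \<omega> - W s \<omega>))
     (\<lambda>z. ennreal (normal_density 0 (sqrt s) (fst z) * normal_density 0 (sqrt u) (snd z)))"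
proof -
  interpret prob_space M by (rule brownian_setup_prob_space[OF bm])
  have "indep_var borel (W s) borel (\<lambda>\<omega>. W (s + u) \<omega> - W s \<omega>)"
    using s u by (intro brownian_indep_increment[OF bm] brownian_adapted[OF bm]) auto
  then have "indep_var lborel (W s) lborel (\<lambda>\<omega>. W (s + u) \<omega> - W s \<omega>)"
    by (simp add: indep_var_eq)
  then have "distributed M (lborel \<Otimes>\<^sub>M lborel) (\<lambda>\<omega>. (W s \<omega>, W (s + u) \<omega> - W s \<omega>))
     (\<lambda>(x, y). ennreal (normal_density 0 (sqrt s) x) * ennreal (normal_density 0 (sqrt u) y))"
    using brownian_distributed[OF bm s] brownian_increment_distributed[OF bm, of s "s + u"] s u
    by (intro distributed_joint_indep) (auto simp: lborel.sigma_finite_measure_axioms)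
  then show ?thesis by (simp add: case_prod_unfold ennreal_mult)
qed

text \<open>
  The joint density of the two increments is positive everywhere, so an event of full probability
  cannot avoid a nonempty open rectangle. It is used to find a good path with a prescribed
  behaviour at times \<open>1\<close> and \<open>2\<close>.
\<close>

lemma brownian_increments_positive_prob:
  assumes bm: "brownian_setup M F W" and A: "open A" "A \<noteq> {}" and B: "open B" "B \<noteq> {}"
    and ae: "AE \<omega> in M. P \<omega>"
  shows "\<exists>\<omega>\<in>space M. P \<omega> \<and> W 1 \<omega> \<in> A \<and> W 2 \<omega> - W 1 \<omega> \<in> B"
proof (rule ccontr)
  assume none: "\<not> ?thesis"
  interpret prob_space M by (rule brownian_setup_prob_space[OF bm])
  let ?p = "\<lambda>z. normal_density 0 (sqrt 1) (fst z) * normal_density 0 (sqrt 1) (snd z)"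
  have D: "distributed M (lborel \<Otimes>\<^sub>M lborel) (\<lambda>\<omega>. (W 1 \<omega>, W 2 \<omega> - W 1 \<omega>)) (\<lambda>z. ennreal (?p z))"
    using brownian_joint_distributed[OF bm, of 1 1] by simp
  have AB: "A \<times> B \<in> sets (lborel \<Otimes>\<^sub>M lborel)" using A B by auto
  have "AE \<omega> in M. (W 1 \<omega>, W 2 \<omega> - W 1 \<omega>) \<notin> A \<times> B"
    using AE_space ae by eventually_elim (use none in auto)
  then have "AE z in lborel \<Otimes>\<^sub>M lborel. 0 < ennreal (?p z) \<longrightarrow> z \<notin> A \<times> B"
    by (rule distributed_AE2[OF D, THEN iffD1, rotated]) (use AB in measurable)
  then have "AE z in lborel \<Otimes>\<^sub>M lborel. z \<notin> A \<times> B"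
    by eventually_elim (auto simp: normal_density_pos)
  then have "emeasure (lborel \<Otimes>\<^sub>M lborel) (A \<times> B) = 0"
    using AE_iff_null_sets[OF AB] by (simp add: null_sets_def)
  then have "emeasure lborel A = 0 \<or> emeasure lborel B = 0"
    using A B by (simp add: lborel.emeasure_pair_measure_Times)
  moreover have "emeasure lborel S \<noteq> 0" if "open S" "S \<noteq> {}" for S :: "real set"
    using open_not_negligible[OF that] that
    by (auto simp: negligible_iff_null_sets null_sets_def)
  ultimately show False using A B by blast
qed

section \<open>Martingales of the form f(W)\<close>

lemma brownian_path_continuous_AE:
  "brownian_setup M F W \<Longrightarrow> AE \<omega> in M. continuous_on {0..} (\<lambda>t. W t \<omega>)"
  by (simp add: brownian_setup_def brownian_motion_wrt_def standard_brownian_motion_def)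

text \<open>
  Some good path is below \<open>a\<close> at time \<open>1\<close> and above \<open>a\<close> at time \<open>2\<close>, and some good path does the
  opposite. The first makes \<open>f\<close> right-continuous at \<open>a\<close>, the second left-continuous.
\<close>

lemma right_continuous_along_brownian_imp_continuous:
  assumes bm: "brownian_setup M F W"
    and rc: "AE \<omega> in M. \<forall>t\<ge>0. continuous (at_right t) (\<lambda>s. f (W s \<omega>))"
  shows "continuous_on UNIV (f :: real \<Rightarrow> real)"
proof -
  let ?P = "\<lambda>\<omega>. continuous_on {0..} (\<lambda>t. W t \<omega>) \<and> (\<forall>t\<ge>0. continuous (at_right t) (\<lambda>s. f (W s \<omega>)))"
  have good: "AE \<omega> in M. ?P \<omega>" using brownian_path_continuous_AE[OF bm] rc by simp
  have "isCont f a" for a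
  proof -
    obtain \<omega> where \<omega>: "?P \<omega>" "W 1 \<omega> \<in> {a - 1<..<a}" "W 2 \<omega> - W 1 \<omega> \<in> {1<..<2}"
      using brownian_increments_positive_prob[OF bm _ _ _ _ good, of "{a - 1<..<a}" "{1<..<2}"] by auto
    then have right: "continuous (at_right a) f"
      by (intro continuous_at_right_of_upcrossing[of "\<lambda>t. W t \<omega>" f 1 2 a]) auto
    obtain \<omega>' where \<omega>': "?P \<omega>'" "W 1 \<omega>' \<in> {a<..<a + 1}" "W 2 \<omega>' - W 1 \<omega>' \<in> {-2<..<-1}"
      using brownian_increments_positive_prob[OF bm _ _ _ _ good, of "{a<..<a + 1}" "{-2<..<-1}"] by auto
    then have "continuous (at_left a) f"
      by (intro continuous_at_left_of_downcrossing[of "\<lambda>t. W t \<omega>'" f 1 2 a]) auto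
    with right show ?thesis by (simp add: continuous_within filterlim_at_split)
  qed
  then show ?thesis by (simp add: continuous_at_imp_continuous_on)
qed

text \<open>
  Conditioning on time \<open>1\<close> and testing with the events \<open>W\<^sub>1 \<in> A\<close> turns the martingale property at
  times \<open>1\<close> and \<open>1 + u\<close> into an equality of integrals over \<open>A\<close> against the density \<open>\<phi>\<close> of \<open>W\<^sub>1\<close>: by
  independence and Fubini one side integrates the Gaussian mean of \<open>f\<close>, the other \<open>f\<close> itself. As
  \<open>A\<close> is arbitrary and \<open>\<phi> > 0\<close>, the integrands agree almost everywhere.
\<close>

lemma martingale_imp_gaussian_mean_AE:
  assumes bm: "brownian_setup M F W" and mart: "martingale M F (\<lambda>t \<omega>. f (W t \<omega>))"
    and f[measurable]: "f \<in> borel_measurable borel" and u: "0 < u"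
  shows "AE x in lborel. (\<integral>y. normal_density 0 (sqrt u) y * f (x + y) \<partial>lborel) = f x"
proof -
  interpret prob_space M by (rule brownian_setup_prob_space[OF bm])
  let ?\<phi> = "normal_density 0 (sqrt 1)" and ?\<psi> = "normal_density 0 (sqrt u)"
  let ?m = "\<lambda>x. \<integral>y. ?\<psi> y * f (x + y) \<partial>lborel"
  interpret cond: finite_measure_subalgebra M "F 1"
    by (rule brownian_finite_measure_subalgebra[OF bm]) simp
  have int: "integrable M (\<lambda>\<omega>. f (W t \<omega>))" if "0 \<le> t" for t
    using mart that by (simp add: martingale_def)
  have mart_eq: "AE \<omega> in M. real_cond_exp M (F 1) (\<lambda>\<omega>. f (W (1 + u) \<omega>)) \<omega> = f (W 1 \<omega>)"
    using mart u unfolding martingale_def by simp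
  have D1: "distributed M lborel (W 1) ?\<phi>" using brownian_distributed[OF bm, of 1] by simp
  note D2 = brownian_joint_distributed[OF bm zero_less_one u]
  let ?k = "\<lambda>z. ?\<phi> (fst z) * ?\<psi> (snd z) * f (fst z + snd z)"
  have k_int: "integrable (lborel \<Otimes>\<^sub>M lborel) ?k"
    using int[of "1 + u"] u by (subst distributed_integrable[OF D2]) auto
  have left: "integrable lborel (\<lambda>x. ?\<phi> x * f x)"
    using int[of 1] by (subst distributed_integrable[OF D1]) auto
  have right: "integrable lborel (\<lambda>x. ?\<phi> x * ?m x)"
    using lborel_pair.integrable_fst'[OF k_int] by (simp add: mult.assoc)
  have "AE x in lborel. ?\<phi> x * f x = ?\<phi> x * ?m x"
  proof (rule density_unique_real[OF left right])
    fix A :: "real set" assume "A \<in> sets lborel"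
    then have A[measurable]: "A \<in> sets borel" by simp
    let ?E = "W 1 -` A \<inter> space M"
    have E: "?E \<in> sets (F 1)"
      using measurable_sets[OF brownian_adapted[OF bm] A, of 1]
        brownian_subalgebra[OF bm, of 1] by (simp add: subalgebra_def)
    have E_M: "?E \<in> sets M" using E brownian_subalgebra[OF bm, of 1] by (auto simp: subalgebra_def)
    have ind: "indicator ?E \<omega> = (indicator A (W 1 \<omega>) :: real)" if "\<omega> \<in> space M" for \<omega>
      using that by (simp add: indicator_def)
    have kA_int: "integrable (lborel \<Otimes>\<^sub>M lborel) (\<lambda>z. indicator (A \<times> UNIV) z *\<^sub>R ?k z)"
      by (rule integrable_mult_indicator[OF _ k_int]) auto
    have "(\<integral>x\<in>A. ?\<phi> x * f x \<partial>lborel) = (\<integral>x. ?\<phi> x * (indicator A x * f x) \<partial>lborel)"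
      by (simp add: set_lebesgue_integral_def mult_ac)
    also have "\<dots> = (\<integral>\<omega>. indicator A (W 1 \<omega>) * f (W 1 \<omega>) \<partial>M)"
      by (rule distributed_integral[OF D1]) auto
    also have "\<dots> = (\<integral>\<omega>\<in>?E. f (W 1 \<omega>) \<partial>M)"
      unfolding set_lebesgue_integral_def by (intro Bochner_Integration.integral_cong) (simp_all add: ind)
    also have "\<dots> = (\<integral>\<omega>\<in>?E. real_cond_exp M (F 1) (\<lambda>\<omega>. f (W (1 + u) \<omega>)) \<omega> \<partial>M)"
    proof (rule set_lebesgue_integral_cong_AE)
      show "AE \<omega>\<in>?E in M. f (W 1 \<omega>) = real_cond_exp M (F 1) (\<lambda>\<omega>. f (W (1 + u) \<omega>)) \<omega>"
        using mart_eq by eventually_elim simp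
    qed (use E_M int[of 1] in auto)
    also have "\<dots> = (\<integral>\<omega>\<in>?E. f (W (1 + u) \<omega>) \<partial>M)"
      using cond.real_cond_exp_intA[OF int[of "1 + u"] E] u by simp
    also have "\<dots> = (\<integral>\<omega>. indicator (A \<times> UNIV) (W 1 \<omega>, W (1 + u) \<omega> - W 1 \<omega>) *
        f (fst (W 1 \<omega>, W (1 + u) \<omega> - W 1 \<omega>) + snd (W 1 \<omega>, W (1 + u) \<omega> - W 1 \<omega>)) \<partial>M)"
      unfolding set_lebesgue_integral_def
      by (intro Bochner_Integration.integral_cong) (simp_all add: ind indicator_times)
    also have "\<dots> = (\<integral>z. ?\<phi> (fst z) * ?\<psi> (snd z) * (indicator (A \<times> UNIV) z * f (fst z + snd z))
        \<partial>(lborel \<Otimes>\<^sub>M lborel))"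
      by (rule distributed_integral[OF D2, symmetric]) auto
    also have "\<dots> = (\<integral>z. indicator (A \<times> UNIV) z *\<^sub>R ?k z \<partial>(lborel \<Otimes>\<^sub>M lborel))"
      by (simp add: mult_ac)
    also have "\<dots> = (\<integral>x. \<integral>y. indicator (A \<times> UNIV) (x, y) *\<^sub>R ?k (x, y) \<partial>lborel \<partial>lborel)"
      by (rule lborel_pair.integral_fst'[OF kA_int, symmetric])
    also have "\<dots> = (\<integral>x\<in>A. ?\<phi> x * ?m x \<partial>lborel)"
      by (simp add: set_lebesgue_integral_def indicator_times mult.assoc)
    finally show "(\<integral>x\<in>A. ?\<phi> x * f x \<partial>lborel) = (\<integral>x\<in>A. ?\<phi> x * ?m x \<partial>lborel)" .
  qed
  then show ?thesis
  proof eventually_elim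
    case (elim x)
    moreover have "0 < ?\<phi> x" by (rule normal_density_pos) simp
    ultimately show ?case by simp
  qed
qed

lemma rc_martingale_imp_linear:
  assumes bm: "brownian_setup M F W" and mart: "(\<lambda>t \<omega>. f (W t \<omega>)) \<in> rc_martingales M F"
    and zero: "AE \<omega> in M. f (W 0 \<omega>) = 0"
  shows "\<exists>c. \<forall>x. f x = c * x"
proof -
  interpret prob_space M by (rule brownian_setup_prob_space[OF bm])
  have m: "martingale M F (\<lambda>t \<omega>. f (W t \<omega>))" using mart by (simp add: rc_martingales_def)
  have cont: "continuous_on UNIV f"
    using mart by (intro right_continuous_along_brownian_imp_continuous[OF bm])
      (simp add: rc_martingales_def)
  then have meas: "f \<in> borel_measurable borel" by (rule borel_measurable_continuous_onI)
  have harm: "gaussian_harmonic f"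
  proof (rule gaussian_harmonicI_AE[OF cont])
    fix u :: real assume u: "0 < u"
    show "integrable lborel (\<lambda>y. normal_density 0 (sqrt u) y * f y)"
      using m u meas by (subst distributed_integrable[OF brownian_distributed[OF bm u]])
        (auto simp: martingale_def)
    show "AE x in lborel. (\<integral>y. normal_density 0 (sqrt u) y * f (x + y) \<partial>lborel) = f x"
      by (rule martingale_imp_gaussian_mean_AE[OF bm m meas u])
  qed
  have "AE \<omega> in M. f 0 = 0"
    using zero brownian_start_AE[OF bm] by eventually_elim simp
  then have "f 0 = 0" by simp
  then have "f x = f 1 * x" for x using gaussian_harmonic_imp_affine[OF harm cont, of x] by simp
  then show ?thesis by blast
qed

lemma brownian_integrable:
  assumes bm: "brownian_setup M F W" and t: "0 \<le> t"
  shows "integrable M (W t)"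
proof -
  interpret prob_space M by (rule brownian_setup_prob_space[OF bm])
  show ?thesis
  proof (cases "t = 0")
    case True
    have "integrable M (\<lambda>_. 0 :: real)" by simp
    then show ?thesis
      unfolding True by (rule integrable_cong_AE_imp)
        (use brownian_start_AE[OF bm] brownian_measurable[OF bm, of 0] in auto)
  next
    case False
    with t have "0 < t" by simp
    then show ?thesis
      using integrable_normal_moment_nz_1[of "sqrt t" 0]
      by (intro distributed_integrable_var[OF brownian_distributed[OF bm]]) auto
  qed
qed

lemma brownian_increment_mean_zero:
  assumes bm: "brownian_setup M F W" and st: "0 \<le> s" "s \<le> t" and A: "A \<in> sets (F s)"
  shows "(\<integral>\<omega>\<in>A. W t \<omega> \<partial>M) = (\<integral>\<omega>\<in>A. W s \<omega> \<partial>M)"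
proof (cases "s = t")
  case False
  with st have lt: "s < t" by simp
  interpret prob_space M by (rule brownian_setup_prob_space[OF bm])
  have A_M: "A \<in> sets M" using A brownian_subalgebra[OF bm st(1)] by (auto simp: subalgebra_def)
  have Wt: "integrable M (W t)" and Ws: "integrable M (W s)"
    using brownian_integrable[OF bm] st by auto
  have ind_A: "indicator A \<in> borel_measurable (F s)" using A by (rule borel_measurable_indicator)
  have ind_int: "integrable M (indicator A :: _ \<Rightarrow> real)"
    by (rule integrable_real_indicator) (use A_M in \<open>auto simp: emeasure_eq_measure\<close>)
  have "(\<integral>\<omega>. W t \<omega> - W s \<omega> \<partial>M) = 0"
    using distributed_integral[OF brownian_increment_distributed[OF bm st(1) lt], of "\<lambda>x. x"]
      integral_normal_moment_nz_1[of "sqrt (t - s)" 0] lt by simp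
  then have "(\<integral>\<omega>. indicator A \<omega> * (W t \<omega> - W s \<omega>) \<partial>M) = 0"
    using indep_var_lebesgue_integral[OF brownian_indep_increment[OF bm st ind_A] ind_int]
      Wt Ws by simp
  moreover have "(\<integral>\<omega>. indicator A \<omega> * (W t \<omega> - W s \<omega>) \<partial>M) =
      (\<integral>\<omega>\<in>A. W t \<omega> \<partial>M) - (\<integral>\<omega>\<in>A. W s \<omega> \<partial>M)"
    using integrable_mult_indicator[OF A_M Wt] integrable_mult_indicator[OF A_M Ws]
    by (simp add: set_lebesgue_integral_def right_diff_distrib)
  ultimately show ?thesis by simp
qed simp

lemma linear_of_brownian_rc_martingale:
  assumes bm: "brownian_setup M F W"
  shows "(\<lambda>t \<omega>. c * W t \<omega>) \<in> rc_martingales M F"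
proof -
  interpret prob_space M by (rule brownian_setup_prob_space[OF bm])
  have "AE \<omega> in M. real_cond_exp M (F s) (\<lambda>\<omega>. c * W t \<omega>) \<omega> = c * W s \<omega>" if st: "0 \<le> s" "s \<le> t" for s t
  proof -
    interpret cond: finite_measure_subalgebra M "F s"
      by (rule brownian_finite_measure_subalgebra[OF bm st(1)])
    show ?thesis
    proof (rule cond.real_cond_exp_charact)
      fix A assume "A \<in> sets (F s)"
      from brownian_increment_mean_zero[OF bm st this]
      show "(\<integral>\<omega>\<in>A. c * W t \<omega> \<partial>M) = (\<integral>\<omega>\<in>A. c * W s \<omega> \<partial>M)" by simp
    qed (use st brownian_integrable[OF bm] brownian_adapted[OF bm] in auto)
  qed
  moreover have "AE \<omega> in M. \<forall>t\<ge>0. continuous (at_right t) (\<lambda>s. c * W s \<omega>)"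
    using brownian_path_continuous_AE[OF bm]
  proof eventually_elim
    case (elim \<omega>)
    show ?case
    proof (intro allI impI)
      fix t :: real assume t: "0 \<le> t"
      have "continuous_on {0..} (\<lambda>s. c * W s \<omega>)" using elim by (intro continuous_intros)
      then have "continuous (at t within {0..}) (\<lambda>s. c * W s \<omega>)"
        using t by (simp add: continuous_on_eq_continuous_within)
      then show "continuous (at_right t) (\<lambda>s. c * W s \<omega>)"
        using t by (rule_tac continuous_within_subset) auto
    qed
  qed
  ultimately show ?thesis
    using brownian_integrable[OF bm] brownian_adapted[OF bm]
    by (auto simp: rc_martingales_def martingale_def)
qed

section \<open>The almost sure Cauchy equation\<close>

text \<open>
  For Borel sets this is positivity of the density of \<open>W\<^sub>t\<close>. A Lebesgue measurable exceptional set
  is a Borel set together with a Lebesgue null set, and only its Borel part has to be tested.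
\<close>

lemma AE_brownian_imp_AE_lebesgue:
  assumes bm: "brownian_setup M F W" and t: "0 < t"
    and P: "{x. P x} \<in> sets lebesgue" and ae: "AE \<omega> in M. P (W t \<omega>)"
  shows "AE x in lebesgue. P x"
proof -
  define S where "S = - {x. P x}"
  have S: "S \<in> sets lebesgue" using sets.compl_sets[OF P] by (simp add: S_def Compl_eq_Diff_UNIV)
  let ?A = "main_part lborel S"
  have A: "?A \<in> sets borel" using main_part_sets[OF S] by simp
  have "?A \<subseteq> S" using main_part_null_part_Un[OF S] by blast
  then have "AE \<omega> in M. W t \<omega> \<notin> ?A" using ae by (auto simp: S_def elim!: eventually_mono)
  then have "AE x in lborel. 0 < ennreal (normal_density 0 (sqrt t) x) \<longrightarrow> x \<notin> ?A"
    by (rule prob_space.distributed_AE2[OF brownian_setup_prob_space[OF bm]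
          brownian_distributed[OF bm t], THEN iffD1, rotated]) (use A in measurable)
  then have "AE x in lborel. x \<notin> ?A"
    by eventually_elim (use t in \<open>auto simp: normal_density_pos\<close>)
  moreover have "AE x in lborel. x \<notin> null_part lborel S" by (rule AE_notin_null_part[OF S])
  ultimately have "AE x in lborel. x \<notin> S"
    by eventually_elim (subst main_part_null_part_Un[OF S, symmetric], simp)
  then show ?thesis by (intro AE_completion) (simp add: S_def)
qed

lemma borel_measurable_lebesgue_translation:
  fixes f :: "real \<Rightarrow> real"
  assumes "f \<in> borel_measurable lebesgue"
  shows "(\<lambda>y. f (x + y)) \<in> borel_measurable lebesgue"
proof (rule measurableI)
  fix A :: "real set" assume "A \<in> sets borel"
  then have "f -` A \<in> sets lebesgue" using measurable_sets[OF assms, of A] by simp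
  then have "(\<lambda>y. - x + y) ` (f -` A) \<in> sets lebesgue" by (rule lebesgue_sets_translation)
  moreover have "(\<lambda>y. - x + y) ` (f -` A) = (\<lambda>y. f (x + y)) -` A"
    by (force simp: image_iff)
  ultimately show "(\<lambda>y. f (x + y)) -` A \<inter> space lebesgue \<in> sets lebesgue" by simp
qed simp

lemma AE_lborel_translation:
  fixes P :: "real \<Rightarrow> bool"
  assumes "AE y in lborel. P y"
  shows "AE y in lborel. P (x + y)"
proof -
  obtain N where N: "N \<in> null_sets lborel" "{y. \<not> P y} \<subseteq> N"
    using assms by (auto elim!: AE_E simp: null_sets_def)
  have "{y. y - (- x) \<in> N} \<in> null_sets lborel" by (rule null_sets_translation[OF N(1)])
  then show ?thesis by (rule AE_I') (use N(2) in \<open>auto simp: add.commute\<close>)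
qed

text \<open>
  For almost every \<open>z\<close> both \<open>f (x + y) + f z\<close> and \<open>f x + f y + f z\<close> equal \<open>f (x + y + z)\<close>; one
  such \<open>z\<close> is enough.
\<close>

lemma AE_additive_imp_additive:
  fixes f :: "real \<Rightarrow> real"
  assumes ae: "\<And>x. AE y in lborel. f (x + y) = f x + f y"
  shows "f (x + y) = f x + f y"
proof -
  have "AE z in lborel. f (x + y) + f z = f x + f y + f z"
    using ae[of "x + y"] ae[of y] AE_lborel_translation[OF ae[of x], of y]
    by eventually_elim (simp add: add.assoc)
  then obtain z where "f (x + y) + f z = f x + f y + f z"
    using AE_lborel_sequence[of "\<lambda>z. f (x + y) + f z = f x + f y + f z"] by metis
  then show ?thesis by simp
qed

lemma AE_additive_at_brownian_imp_additive:
  fixes f :: "real \<Rightarrow> real"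
  assumes bm: "brownian_setup M F W" and meas: "f \<in> borel_measurable lebesgue"
    and t: "0 < t" and ae: "\<And>x. AE \<omega> in M. f (x + W t \<omega>) = f x + f (W t \<omega>)"
  shows "f (x + y) = f x + f y"
proof (rule AE_additive_imp_additive)
  fix x
  note [measurable] = meas borel_measurable_lebesgue_translation[OF meas, of x]
  have "{y \<in> space lebesgue. f (x + y) = f x + f y} \<in> sets lebesgue" by measurable
  then have "{y. f (x + y) = f x + f y} \<in> sets lebesgue" by simp
  from AE_brownian_imp_AE_lebesgue[OF bm t this ae]
  show "AE y in lborel. f (x + y) = f x + f y" by (simp add: AE_completion_iff)
qed

section \<open>Equivalence of the four assertions\<close>

theorem theorem2p1:
  fixes M :: "'a measure" and F :: "real \<Rightarrow> 'a measure" and W :: "real \<Rightarrow> 'a \<Rightarrow> real"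
    and f :: "real \<Rightarrow> real"
  assumes "brownian_setup M F W"
  shows
    "((f \<in> borel_measurable lebesgue \<and> (\<forall>x y. f (x + y) = f x + f y))
        \<longleftrightarrow>
      (f \<in> borel_measurable lebesgue \<and>
        (\<forall>t\<ge>0. \<forall>x. AE \<omega> in M. f (x + W t \<omega>) = f x + f (W t \<omega>)))) \<and>
     ((f \<in> borel_measurable lebesgue \<and>
        (\<forall>t\<ge>0. \<forall>x. AE \<omega> in M. f (x + W t \<omega>) = f x + f (W t \<omega>)))
        \<longleftrightarrow>
      ((\<lambda>t \<omega>. f (W t \<omega>)) \<in> rc_martingales M F \<and> (AE \<omega> in M. f (W 0 \<omega>) = 0))) \<and>
     (((\<lambda>t \<omega>. f (W t \<omega>)) \<in> rc_martingales M F \<and> (AE \<omega> in M. f (W 0 \<omega>) = 0))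
        \<longleftrightarrow>
      (\<exists>c. \<forall>x. f x = c * x))"
    (is "(?a \<longleftrightarrow> ?b) \<and> (?b \<longleftrightarrow> ?c) \<and> (?c \<longleftrightarrow> ?d)")
proof -
  have ab: ?b if ?a using that by simp
  have bd: ?d if b: ?b
  proof (rule measurable_additive_imp_linear)
    show "f \<in> borel_measurable lebesgue" using b by simp
    show "f (x + y) = f x + f y" for x y
      by (rule AE_additive_at_brownian_imp_additive[OF assms, of f 1]) (use b in auto)
  qed
  have cd: ?d if ?c using rc_martingale_imp_linear[OF assms, of f] that by blast
  have da: ?a and dc: ?c if ?d
  proof -
    from that obtain c where f: "f = (\<lambda>x. c * x)" by auto
    have "(\<lambda>x. c * x) \<in> borel_measurable borel" by measurable
    then show ?a by (auto simp: f algebra_simps intro!: measurable_completion)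
    show ?c
      using linear_of_brownian_rc_martingale[OF assms, of c] brownian_start_AE[OF assms]
      by (auto simp: f elim: eventually_mono)
  qed
  show ?thesis using ab bd cd da dc by blast
qed

end
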